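(* For all integers $k\ge 0$ and $n\ge k+2$, $\mathrm{av}_n^k(1324,1432)$ equals the number of partitions of $k$ into blue and red parts such that all blue parts are greater than or equal to all red parts. In particular, $$C_{1324,1432}(x)=\sum_{k\ge 0}(k+1)x^k\cdot\prod_{i=1}^k\frac{1}{1-x^i}.$$
   Context: $\mathrm{av}_n^k(B)$ is the number of permutations in $S_n$ with exactly $k$ inversions (pairs $i<j$ with $\pi_i>\pi_j$) that avoid every pattern in $B$; a permutation avoids a pattern $q$ if it has no subsequence order-isomorphic to $q$. If for every $k\ge0$ there are constants $m_k,c_k(B)$ with $\mathrm{av}_n^k(B)=c_k(B)$ for all $n\ge m_k$, then $(c_k(B))_{k\ge0}$ is the limit sequence of $B$ and $C_B(x)=\sum_{k\ge 0}c_k(B)x^k$ is its limit generating function. A partition of $k$ into blue and red parts is a pair consisting of a partition (multiset) of blue parts and a partition (multiset) of red parts, either possibly empty, with total sum $k$. *)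

theory Defs
  imports
    "HOL-Combinatorics.Multiset_Permutations"
    "HOL-Library.Sublist"
    "HOL-Computational_Algebra.Formal_Power_Series"
begin

text \<open>
  Permutations and patterns are lists in one-line notation; the symmetric group on
  \<open>n\<close> letters is \<^term>\<open>permutations_of_set {1..n}\<close>.
\<close>

definition order_isomorphic :: "nat list \<Rightarrow> nat list \<Rightarrow> bool" where
  "order_isomorphic s q \<longleftrightarrow> length s = length q \<and>
     (\<forall>i<length q. \<forall>j<length q. s ! i < s ! j \<longleftrightarrow> q ! i < q ! j)"

definition avoids :: "nat list \<Rightarrow> nat list \<Rightarrow> bool" where
  "avoids \<pi> q \<longleftrightarrow> \<not> (\<exists>s. subseq s \<pi> \<and> order_isomorphic s q)"

definition inversions :: "nat list \<Rightarrow> (nat \<times> nat) set" where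
  "inversions \<pi> = {(i, j). i < j \<and> j < length \<pi> \<and> \<pi> ! i > \<pi> ! j}"

definition av :: "nat \<Rightarrow> nat \<Rightarrow> nat list set \<Rightarrow> nat" where
  "av n k B = card {\<pi> \<in> permutations_of_set {1..n}.
     card (inversions \<pi>) = k \<and> (\<forall>q\<in>B. avoids \<pi> q)}"

definition is_limit_seq :: "nat list set \<Rightarrow> (nat \<Rightarrow> nat) \<Rightarrow> bool" where
  "is_limit_seq B c \<longleftrightarrow> (\<forall>k. \<exists>m. \<forall>n\<ge>m. av n k B = c k)"

text \<open>Meaningful only if a limit sequence exists; it is then unique.\<close>

definition limit_seq :: "nat list set \<Rightarrow> nat \<Rightarrow> nat" where
  "limit_seq B = (THE c. is_limit_seq B c)"

lemma is_limit_seq_unique: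
  assumes "is_limit_seq B c" and "is_limit_seq B d"
  shows "c = d"
proof
  fix k
  obtain m m' where "\<forall>n\<ge>m. av n k B = c k" and "\<forall>n\<ge>m'. av n k B = d k"
    using assms unfolding is_limit_seq_def by blast
  then show "c k = d k"
    by (metis max.cobounded1 max.cobounded2)
qed

lemma limit_seq_eq: "is_limit_seq B c \<Longrightarrow> limit_seq B = c"
  unfolding limit_seq_def using is_limit_seq_unique by blast

definition limit_gf :: "nat list set \<Rightarrow> rat fps" where
  "limit_gf B = Abs_fps (\<lambda>k. of_nat (limit_seq B k))"

text \<open>Pairs of the multiset of blue parts and the multiset of red parts.\<close>

definition blue_red_partitions :: "nat \<Rightarrow> (nat multiset \<times> nat multiset) set" where
  "blue_red_partitions k =
     {(blue, red). 0 \<notin># blue \<and> 0 \<notin># red \<and> \<Sum>\<^sub># blue + \<Sum>\<^sub># red = k}"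

end

theory Submission
  imports Defs
begin

text \<open>
  A permutation of \<open>n \<ge> k + 2\<close> letters with \<open>k\<close> inversions is a direct sum \<open>\<sigma> \<oplus> \<tau>\<close> of two nonempty
  permutations, and such a sum avoids 1324 and 1432 iff \<open>\<sigma>\<close> avoids 132 and \<open>\<tau>\<close> avoids 213 and 321.
  In terms of Lehmer codes, the former means that the code of \<open>\<sigma>\<close> is weakly decreasing, i.e. a
  partition padded with zeros, and the latter that the code of \<open>\<tau>\<close> is \<open>0\<^sup>c b\<^sup>a 0\<^sup>b\<close>. So
  the permutations correspond to a partition of \<open>k - a b\<close> together with \<open>a\<close> copies of \<open>b\<close>, that is, to
  a partition \<open>M\<close> of \<open>k\<close> with \<open>1 \<le> a \<le>\<close> the multiplicity of \<open>b\<close> in \<open>M\<close>, or \<open>a = b = 0\<close>. This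
  leaves \<open>size M + 1\<close> choices for each \<open>M\<close>, as many as there are ways to colour the smallest parts
  of \<open>M\<close> red and the others blue.
\<close>

subsection \<open>Lehmer codes\<close>

fun lehmer :: "'a::linorder list \<Rightarrow> nat list" where
  "lehmer [] = []"
| "lehmer (x # xs) = length (filter (\<lambda>y. y < x) xs) # lehmer xs"

text \<open>The condition for being a Lehmer code: no entry exceeds the number of entries after
  it.\<close>

fun subdiagonal :: "nat list \<Rightarrow> bool" where
  "subdiagonal [] \<longleftrightarrow> True"
| "subdiagonal (e # c) \<longleftrightarrow> e \<le> length c \<and> subdiagonal c"

lemma length_lehmer [simp]: "length (lehmer xs) = length xs"
  by (induction xs) auto

lemma lehmer_sorted: "sorted xs \<Longrightarrow> lehmer xs = replicate (length xs) 0"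
proof (induction xs)
  case (Cons x xs)
  then have "filter (\<lambda>y. y < x) xs = []"
    by (auto simp: filter_empty_conv)
  with Cons show ?case by simp
qed simp

lemma lehmer_append_less:
  assumes "\<And>x y. x \<in> set xs \<Longrightarrow> y \<in> set ys \<Longrightarrow> x < y"
  shows "lehmer (xs @ ys) = lehmer xs @ lehmer ys"
  using assms
proof (induction xs)
  case (Cons x xs)
  have "filter (\<lambda>y. y < x) ys = []"
    using Cons.prems by (force simp: filter_empty_conv)
  with Cons show ?case by simp
qed simp

lemma lehmer_append_greater:
  assumes "\<And>x y. x \<in> set xs \<Longrightarrow> y \<in> set ys \<Longrightarrow> y < x"
  shows "lehmer (xs @ ys) = map ((+) (length ys)) (lehmer xs) @ lehmer ys"
  using assms
proof (induction xs)
  case (Cons x xs)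
  have "filter (\<lambda>y. y < x) ys = ys"
    using Cons.prems by (auto simp: filter_id_conv)
  with Cons show ?case by simp
qed simp

lemma card_inversions: "card (inversions xs) = sum_list (lehmer xs)"
proof (induction xs)
  case Nil
  then show ?case by (simp add: inversions_def)
next
  case (Cons x xs)
  let ?J = "{j. j < length xs \<and> xs ! j < x}"
  \<comment> \<open>Inversions that use the first position are counted by the first code entry; the
    others are inversions of \<open>xs\<close> shifted by one position.\<close>
  have eq: "inversions (x # xs) = (\<lambda>j. (0, Suc j)) ` ?J \<union> map_prod Suc Suc ` inversions xs"
  proof (intro equalityI subsetI)
    fix p assume p: "p \<in> inversions (x # xs)"
    obtain i j where ij: "p = (i, j)" "i < j" "j < Suc (length xs)" "(x # xs) ! i > (x # xs) ! j"
      using p by (auto simp: inversions_def)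
    then obtain j' where j': "j = Suc j'" by (cases j) auto
    show "p \<in> (\<lambda>j. (0, Suc j)) ` ?J \<union> map_prod Suc Suc ` inversions xs"
      using ij j' by (cases i) (auto simp: inversions_def image_iff)
  qed (auto simp: inversions_def)
  have "inversions xs \<subseteq> {..<length xs} \<times> {..<length xs}"
    by (auto simp: inversions_def)
  then have fin: "finite (inversions xs)"
    by (rule finite_subset) simp
  have "card (inversions (x # xs)) = card ?J + card (inversions xs)"
    unfolding eq by (subst card_Un_disjoint)
      (auto simp: fin card_image inj_on_def map_prod_def split: prod.splits)
  with Cons show ?case by (simp add: length_filter_conv_card)
qed

section \<open>Ranks, and the bijection between permutations and codes\<close>

lemma length_filter_less_eq_card:
  fixes xs :: "'a::linorder list"
  assumes "distinct (x # xs)"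
  shows "length (filter (\<lambda>y. y < x) xs) = card {y \<in> set (x # xs). y < x}"
proof -
  have "length (filter (\<lambda>y. y < x) xs) = card ({y. y < x} \<inter> set xs)"
    using assms by (intro distinct_length_filter) auto
  also have "{y. y < x} \<inter> set xs = {y \<in> set (x # xs). y < x}" by auto
  finally show ?thesis .
qed

lemma rank_inj_on:
  fixes A :: "'a::linorder set"
  assumes "finite A"
  shows "inj_on (\<lambda>x. card {y \<in> A. y < x}) A"
proof (rule linorder_inj_onI)
  fix x y assume "x < y" "x \<in> A" "y \<in> A"
  then have "{z \<in> A. z < x} \<subset> {z \<in> A. z < y}" by auto
  then have "card {z \<in> A. z < x} < card {z \<in> A. z < y}"
    using assms by (intro psubset_card_mono) auto
  then show "card {z \<in> A. z < x} \<noteq> card {z \<in> A. z < y}" by simp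
qed auto

text \<open>An injection of \<open>A\<close> into \<open>{..<card A}\<close> is onto.\<close>

lemma rank_surj:
  fixes A :: "'a::linorder set"
  assumes "finite A" and "e < card A"
  obtains x where "x \<in> A" and "card {y \<in> A. y < x} = e"
proof -
  let ?r = "\<lambda>x. card {y \<in> A. y < x}"
  have "?r ` A \<subseteq> {..<card A}"
    using assms(1) by (auto intro!: psubset_card_mono)
  moreover have "card (?r ` A) = card {..<card A}"
    using rank_inj_on[OF assms(1)] by (simp add: card_image)
  ultimately have "?r ` A = {..<card A}"
    by (intro card_subset_eq) auto
  then show thesis using assms(2) that by (metis (no_types, lifting) imageE lessThan_iff)
qed

text \<open>Decoding from the left: the first entry is the rank of the first letter in the set of
  all letters and so fixes that letter; removing it leaves the same problem for the tails.\<close>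

lemma lehmer_eqD:
  assumes "distinct xs" "distinct ys" "set xs = set ys" "lehmer xs = lehmer ys"
  shows "xs = ys"
  using assms
proof (induction xs arbitrary: ys)
  case (Cons x xs)
  then obtain y ys' where ys: "ys = y # ys'" by (cases ys) auto
  have "card {z \<in> set ys. z < x} = card {z \<in> set ys. z < y}"
    using Cons.prems length_filter_less_eq_card[of x xs] length_filter_less_eq_card[of y ys']
    by (simp add: ys)
  then have xy: "x = y"
    using rank_inj_on[of "set ys"] Cons.prems(3) ys by (auto simp: inj_on_def)
  have "set xs = set ys'"
    using Cons.prems xy ys by (metis Diff_insert_absorb distinct.simps(2) list.simps(15))
  then show ?case
    using Cons xy ys by auto
qed auto

text \<open>Decoding again, now for existence: each entry \<open>e\<close> selects the letter of
  rank \<open>e\<close> among those still available, of which there are more than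
  \<open>e\<close>.\<close>

lemma lehmer_surj:
  assumes "finite A" "length c = card A" "subdiagonal c"
  obtains xs :: "'a::linorder list" where "xs \<in> permutations_of_set A" "lehmer xs = c"
proof -
  have "\<exists>xs\<in>permutations_of_set A. lehmer xs = c"
    using assms
  proof (induction c arbitrary: A)
    case (Cons e c)
    then obtain x where x: "x \<in> A" "card {y \<in> A. y < x} = e"
      using rank_surj[of A e] by auto
    obtain xs where xs: "xs \<in> permutations_of_set (A - {x})" "lehmer xs = c"
      using Cons.IH[of "A - {x}"] Cons.prems x by force
    have A: "set (x # xs) = A" "distinct (x # xs)"
      using xs(1) x(1) by (auto dest: permutations_of_setD)
    then have "lehmer (x # xs) = e # c"
      using length_filter_less_eq_card[OF A(2)] x(2) xs(2) by (simp del: set_simps)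
    with A show ?case by (intro bexI[of _ "x # xs"] permutations_of_setI) auto
  qed auto
  with that show thesis by blast
qed

lemma subseq_set_subset: "subseq xs ys \<Longrightarrow> x \<in> set xs \<Longrightarrow> x \<in> set ys"
  by (induction rule: list_emb.induct) auto

subsection \<open>Avoidance of the patterns\<close>

lemma Ex_length_3: "(\<exists>s. length s = 3 \<and> P s) \<longleftrightarrow> (\<exists>a b c. P [a, b, c])"
  by (simp add: numeral_3_eq_3 length_Suc_conv) blast

lemma Ex_length_4: "(\<exists>s. length s = 4 \<and> P s) \<longleftrightarrow> (\<exists>a b c d. P [a, b, c, d])"
  by (simp add: eval_nat_numeral length_Suc_conv) blast

text \<open>Only a subsequence as long as the pattern can be order-isomorphic to it, so avoidance
  becomes an order condition on three named letters.\<close>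

lemma avoids_3:
  assumes "length q = 3" and "\<And>a b c. order_isomorphic [a, b, c] q \<longleftrightarrow> R a b c"
  shows "avoids xs q \<longleftrightarrow> (\<forall>a b c. subseq [a, b, c] xs \<longrightarrow> \<not> R a b c)"
proof -
  have "avoids xs q \<longleftrightarrow> \<not> (\<exists>s. length s = 3 \<and> subseq s xs \<and> order_isomorphic s q)"
    using assms(1) by (auto simp: avoids_def order_isomorphic_def)
  then show ?thesis unfolding Ex_length_3 using assms(2) by auto
qed

lemma avoids_4:
  assumes "length q = 4" and "\<And>a b c d. order_isomorphic [a, b, c, d] q \<longleftrightarrow> R a b c d"
  shows "avoids xs q \<longleftrightarrow> (\<forall>a b c d. subseq [a, b, c, d] xs \<longrightarrow> \<not> R a b c d)"
proof -
  have "avoids xs q \<longleftrightarrow> \<not> (\<exists>s. length s = 4 \<and> subseq s xs \<and> order_isomorphic s q)"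
    using assms(1) by (auto simp: avoids_def order_isomorphic_def)
  then show ?thesis unfolding Ex_length_4 using assms(2) by auto
qed

lemma avoids_132:
  "avoids xs [1,3,2] \<longleftrightarrow> (\<forall>a b c. subseq [a, b, c] xs \<longrightarrow> \<not> (a < c \<and> c < b))"
  by (rule avoids_3) (auto simp: order_isomorphic_def All_less_Suc)

lemma avoids_213:
  "avoids xs [2,1,3] \<longleftrightarrow> (\<forall>a b c. subseq [a, b, c] xs \<longrightarrow> \<not> (b < a \<and> a < c))"
  by (rule avoids_3) (auto simp: order_isomorphic_def All_less_Suc)

lemma avoids_321:
  "avoids xs [3,2,1] \<longleftrightarrow> (\<forall>a b c. subseq [a, b, c] xs \<longrightarrow> \<not> (c < b \<and> b < a))"
  by (rule avoids_3) (auto simp: order_isomorphic_def All_less_Suc)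

lemma avoids_1324:
  "avoids xs [1,3,2,4] \<longleftrightarrow> (\<forall>a b c d. subseq [a, b, c, d] xs \<longrightarrow> \<not> (a < c \<and> c < b \<and> b < d))"
  by (rule avoids_4) (auto simp: order_isomorphic_def All_less_Suc)

lemma avoids_1432:
  "avoids xs [1,4,3,2] \<longleftrightarrow> (\<forall>a b c d. subseq [a, b, c, d] xs \<longrightarrow> \<not> (a < d \<and> d < c \<and> c < b))"
  by (rule avoids_4) (auto simp: order_isomorphic_def All_less_Suc)

lemma all_subseq_3_Cons:
  "(\<forall>a b c. subseq [a, b, c] (x # xs) \<longrightarrow> P a b c) \<longleftrightarrow>
    (\<forall>b c. subseq [b, c] xs \<longrightarrow> P x b c) \<and> (\<forall>a b c. subseq [a, b, c] xs \<longrightarrow> P a b c)"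
  (is "?L \<longleftrightarrow> ?R")
proof
  assume ?L
  then show ?R by (blast intro: list_emb_Cons subseq_Cons2)
next
  assume R: ?R
  have "P a b c" if "subseq [a, b, c] (x # xs)" for a b c
    using that R by (cases "a = x") (simp_all add: subseq_Cons2_iff)
  then show ?L by blast
qed

section \<open>132-avoidance in terms of the code\<close>

lemma length_filter_less_split:
  fixes x w :: "'a::linorder"
  assumes "x \<le> w"
  shows "length (filter (\<lambda>y. y < w) ws) =
    length (filter (\<lambda>y. y < x) ws) + length (filter (\<lambda>y. x \<le> y \<and> y < w) ws)"
  using assms by (induction ws) auto

text \<open>Induction from the right, comparing the entries of the first two letters
  \<open>x\<close> and \<open>w\<close>. The entry of \<open>w\<close> is larger iff
  \<open>x < w\<close> and a later letter lies between them. When the tail avoids 132, this is also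
  the only way in which \<open>x\<close> can start a 132.\<close>

lemma avoids_132_iff_lehmer:
  assumes "distinct xs"
  shows "avoids xs [1,3,2] \<longleftrightarrow> sorted (rev (lehmer xs))"
  using assms
proof (induction xs)
  case (Cons x xs)
  have step: "avoids (x # xs) [1,3,2] \<longleftrightarrow>
      avoids xs [1,3,2] \<and> (\<forall>y z. subseq [y, z] xs \<longrightarrow> \<not> (x < z \<and> z < y))"
    unfolding avoids_132 all_subseq_3_Cons by blast
  show ?case
  proof (cases xs)
    case Nil
    then show ?thesis unfolding step by (simp add: Nil) (simp add: avoids_132 flip: One_nat_def)
  next
    case xs: (Cons w ws)
    have "length (filter (\<lambda>y. y < w) ws) \<le> length (filter (\<lambda>y. y < x) xs) \<longleftrightarrow>
        (\<forall>y z. subseq [y, z] xs \<longrightarrow> \<not> (x < z \<and> z < y))"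
      if av: "avoids xs [1,3,2]"
    proof (cases "w < x")
      case True
      have "length (filter (\<lambda>y. y < w) ws) \<le> length (filter (\<lambda>y. y < x) xs)"
        using True by (simp add: xs length_filter_less_split[of w x ws])
      \<comment> \<open>A 132 starting with \<open>x\<close> would remain one with the smaller
        letter \<open>w\<close> in place of \<open>x\<close>.\<close>
      moreover have "\<not> (x < z \<and> z < y)" if "subseq [y, z] xs" for y z
        using that av True unfolding avoids_132 xs
        by (metis less_trans not_less_iff_gr_or_eq subseq_Cons2_iff)
      ultimately show ?thesis by blast
    next
      case False
      with Cons.prems have xw: "x < w" by (auto simp: xs)
      have iff1: "length (filter (\<lambda>y. y < w) ws) \<le> length (filter (\<lambda>y. y < x) ws) \<longleftrightarrow>
          (\<forall>z\<in>set ws. \<not> (x < z \<and> z < w))"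
        using Cons.prems xw
        by (auto simp: length_filter_less_split[of x w] filter_empty_conv xs order_le_less)
      have "(\<forall>z\<in>set ws. \<not> (x < z \<and> z < w)) \<longleftrightarrow>
        (\<forall>y z. subseq [y, z] xs \<longrightarrow> \<not> (x < z \<and> z < y))" (is "?L \<longleftrightarrow> ?R")
      proof
        assume L: ?L
        have "\<not> (x < z \<and> z < y)" if yz: "subseq [y, z] xs" for y z
        proof (cases "y = w")
          case True
          then show ?thesis using L yz by (auto simp: xs subseq_singleton_left)
        next
          case False
          then have sub: "subseq [y, z] ws" using yz by (simp add: xs)
          \<comment> \<open>If \<open>x < z < y\<close>, then \<open>z\<close> is below
            \<open>w\<close>, as otherwise \<open>w, y, z\<close> would be a 132; so
            \<open>z\<close> lies between \<open>x\<close> and \<open>w\<close>.\<close>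
          then have "subseq [w, y, z] xs" by (simp add: xs)
          then have "\<not> (w < z \<and> z < y)" using av unfolding avoids_132 by blast
          moreover have "z \<in> set ws" using subseq_set_subset[OF sub] by simp
          moreover have "w \<noteq> z" using Cons.prems \<open>z \<in> set ws\<close> by (auto simp: xs)
          ultimately show ?thesis using L by (meson linorder_neqE)
        qed
        then show ?R by blast
      next
        assume ?R
        then show ?L by (auto simp: xs subseq_singleton_left)
      qed
      with iff1 False show ?thesis by (simp add: xs)
    qed
    moreover have "sorted (rev (lehmer (x # xs))) \<longleftrightarrow>
        length (filter (\<lambda>y. y < w) ws) \<le> length (filter (\<lambda>y. y < x) xs) \<and> sorted (rev (lehmer xs))"
      by (auto simp: xs sorted_append intro: order_trans)
    moreover have "avoids xs [1,3,2] \<longleftrightarrow> sorted (rev (lehmer xs))"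
      using Cons by simp
    ultimately show ?thesis
      unfolding step by blast
  qed
qed (simp add: avoids_132 flip: One_nat_def)

text \<open>A letter of \<open>ys\<close> extends a 132 in \<open>xs\<close> to a 1324, and a letter
  of \<open>xs\<close> extends a 213 or 321 in \<open>ys\<close> to a 1324 or 1432. Conversely, any
  way of cutting an occurrence of 1324 or 1432 between \<open>xs\<close> and \<open>ys\<close> leads
  to one of these or to a contradiction.\<close>

lemma avoids_append_iff:
  assumes "xs \<noteq> []" "ys \<noteq> []" and less: "\<And>x y. x \<in> set xs \<Longrightarrow> y \<in> set ys \<Longrightarrow> x < y"
  shows "avoids (xs @ ys) [1,3,2,4] \<and> avoids (xs @ ys) [1,4,3,2] \<longleftrightarrow>
    avoids xs [1,3,2] \<and> avoids ys [2,1,3] \<and> avoids ys [3,2,1]"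
proof (intro iffI)
  assume L: "avoids (xs @ ys) [1,3,2,4] \<and> avoids (xs @ ys) [1,4,3,2]"
  have "\<not> (a < c \<and> c < b)" if abc: "subseq [a, b, c] xs" for a b c
  proof -
    have "subseq ([a, b, c] @ [hd ys]) (xs @ ys)"
      using abc assms by (intro list_emb_append_mono) (auto simp: subseq_singleton_left)
    moreover have "b < hd ys"
      using subseq_set_subset[OF abc] assms by auto
    ultimately show ?thesis using L unfolding avoids_1324 by auto
  qed
  moreover have "\<not> (b < a \<and> a < c)" "\<not> (c < b \<and> b < a)" if abc: "subseq [a, b, c] ys" for a b c
  proof -
    have "subseq ([hd xs] @ [a, b, c]) (xs @ ys)"
      using abc assms by (intro list_emb_append_mono) (auto simp: subseq_singleton_left)
    then have sub: "subseq [hd xs, a, b, c] (xs @ ys)" by simp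
    have "hd xs < b" "hd xs < c"
      using subseq_set_subset[OF abc] assms by auto
    then show "\<not> (b < a \<and> a < c)"
      using L sub unfolding avoids_1324 by blast
    show "\<not> (c < b \<and> b < a)"
      using L sub \<open>hd xs < c\<close> unfolding avoids_1432 by blast
  qed
  ultimately show "avoids xs [1,3,2] \<and> avoids ys [2,1,3] \<and> avoids ys [3,2,1]"
    unfolding avoids_132 avoids_213 avoids_321 by blast
next
  assume R: "avoids xs [1,3,2] \<and> avoids ys [2,1,3] \<and> avoids ys [3,2,1]"
  have "\<not> (a < c \<and> c < b \<and> b < d) \<and> \<not> (a < d \<and> d < c \<and> c < b)"
    if abcd: "subseq [a, b, c, d] (xs @ ys)" for a b c d
  proof -
    obtain us vs where split: "[a, b, c, d] = us @ vs" and us: "subseq us xs" and vs: "subseq vs ys"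
      by (rule subseq_appendE[OF abcd])
    from split have "us = [] \<and> vs = [a, b, c, d] \<or> us = [a] \<and> vs = [b, c, d] \<or> us = [a, b] \<and> vs = [c, d]
        \<or> us = [a, b, c] \<and> vs = [d] \<or> us = [a, b, c, d]"
      by (simp add: Cons_eq_append_conv) blast
    then consider "vs = [a, b, c, d]" | "us = [a]" "vs = [b, c, d]" | "us = [a, b]" "vs = [c, d]"
      | "us = [a, b, c]" "vs = [d]" | "us = [a, b, c, d]"
      by blast
    then show ?thesis
    \<comment> \<open>With at most one letter in \<open>xs\<close>, the last three letters form a
      213 or 321 in \<open>ys\<close>. A cut in the middle contradicts \<open>c < b\<close>, which
      both patterns demand. With three letters in \<open>xs\<close>, 1432 contradicts
      \<open>c < d\<close> and 1324 leaves a 132. With all four, \<open>a, b, c\<close> or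
      \<open>a, c, d\<close> is a 132.\<close>
    proof cases
      case 1
      then have "subseq [b, c, d] ys" using vs subseq_Cons'[of a "[b, c, d]" ys] by simp
      then show ?thesis using R unfolding avoids_213 avoids_321 by blast
    next
      case 2
      then have "subseq [b, c, d] ys" using vs by simp
      then show ?thesis using R unfolding avoids_213 avoids_321 by blast
    next
      case 3
      then have "b \<in> set xs" "c \<in> set ys"
        using subseq_set_subset[OF us, of b] subseq_set_subset[OF vs, of c] by auto
      then show ?thesis using less[of b c] 3 us vs subseq_set_subset[of vs ys d] less[of b d] by auto
    next
      case 4
      then have "c \<in> set xs" "d \<in> set ys"
        using subseq_set_subset[OF us, of c] subseq_set_subset[OF vs, of d] by auto
      then have "c < d" using less by blast
      moreover have "subseq [a, b, c] xs" using us 4 by simp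
      then have "\<not> (a < c \<and> c < b)" using R unfolding avoids_132 by blast
      ultimately show ?thesis by auto
    next
      case 5
      then have "subseq [a, b, c] xs" "subseq [a, c, d] xs"
        using us by (auto intro: subseq_order.trans[of _ "[a, b, c, d]" xs])
      then show ?thesis using R unfolding avoids_132 by blast
    qed
  qed
  then show "avoids (xs @ ys) [1,3,2,4] \<and> avoids (xs @ ys) [1,4,3,2]"
    unfolding avoids_1324 avoids_1432 by blast
qed

section \<open>Permutations avoiding 213 and 321\<close>

lemma sorted_subseq: "subseq xs ys \<Longrightarrow> sorted ys \<Longrightarrow> sorted xs"
  by (induction rule: list_emb.induct) (auto dest: subseq_set_subset)

lemma sorted_if_subseq: "(\<And>x y. subseq [x, y] xs \<Longrightarrow> x \<le> y) \<Longrightarrow> sorted xs"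
proof (induction xs)
  case (Cons x xs)
  then have "\<And>y. y \<in> set xs \<Longrightarrow> x \<le> y" by (simp add: subseq_singleton_left)
  moreover have "sorted xs" by (rule Cons.IH, rule Cons.prems, rule list_emb_Cons)
  ultimately show ?case by simp
qed simp

text \<open>The only descent of a subsequence is at the passage from \<open>us\<close> to
  \<open>vs\<close>. So it cannot descend twice, and nothing after the descent exceeds what came
  before it.\<close>

lemma avoids_213_321_append:
  assumes "sorted us" "sorted vs" and less: "\<And>x y. x \<in> set us \<Longrightarrow> y \<in> set vs \<Longrightarrow> y < x"
  shows "avoids (us @ vs) [2,1,3]" "avoids (us @ vs) [3,2,1]"
proof -
  have key: "\<not> (b < a \<and> a < c)" "\<not> (c < b \<and> b < a)" if abc: "subseq [a, b, c] (us @ vs)" for a b c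
  proof -
    obtain xs ys where split: "[a, b, c] = xs @ ys" and xs: "subseq xs us" and ys: "subseq ys vs"
      by (rule subseq_appendE[OF abc])
    have "sorted xs" using xs assms(1) by (rule sorted_subseq)
    moreover have "sorted ys" using ys assms(2) by (rule sorted_subseq)
    moreover have "\<forall>x\<in>set xs. \<forall>y\<in>set ys. y < x"
      by (intro ballI less subseq_set_subset[OF xs] subseq_set_subset[OF ys])
    moreover from split have "xs = [] \<and> ys = [a, b, c] \<or> xs = [a] \<and> ys = [b, c]
        \<or> xs = [a, b] \<and> ys = [c] \<or> xs = [a, b, c] \<and> ys = []"
      by (simp add: Cons_eq_append_conv) blast
    ultimately have "\<not> (b < a \<and> a < c) \<and> \<not> (c < b \<and> b < a)"
      by auto
    then show "\<not> (b < a \<and> a < c)" "\<not> (c < b \<and> b < a)" by blast+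
  qed
  show "avoids (us @ vs) [2,1,3]"
    unfolding avoids_213 by (intro allI impI) (rule key(1))
  show "avoids (us @ vs) [3,2,1]"
    unfolding avoids_321 by (intro allI impI) (rule key(2))
qed

text \<open>Behind the first letter \<open>x\<close>, 213-avoidance puts all larger letters
  (\<open>us\<close>) before all smaller ones (\<open>vs\<close>), and 321-avoidance makes
  \<open>vs\<close> increasing. Hence the new entry is \<open>length vs\<close>: it prepends a zero,
  starts a block, or prolongs the block of the tail.\<close>

lemma lehmer_avoids_213_321:
  assumes "distinct xs" "avoids xs [2,1,3]" "avoids xs [3,2,1]"
  shows "\<exists>c a b. lehmer xs = replicate c 0 @ replicate a b @ replicate b 0"
  using assms
proof (induction xs)
  case Nil
  show ?case by (intro exI[of _ 0]) simp
next
  case (Cons x xs)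
  have pairs: "\<not> (y < x \<and> x < z) \<and> \<not> (z < y \<and> y < x)" if "subseq [y, z] xs" for y z
    using Cons.prems(2,3) that unfolding avoids_213 avoids_321 all_subseq_3_Cons by blast
  have "avoids xs [2,1,3]" "avoids xs [3,2,1]"
    using Cons.prems(2,3) unfolding avoids_213 avoids_321 all_subseq_3_Cons by blast+
  with Cons obtain c a b where IH: "lehmer xs = replicate c 0 @ replicate a b @ replicate b 0"
    by auto
  define us where "us = takeWhile (\<lambda>y. x < y) xs"
  define vs where "vs = dropWhile (\<lambda>y. x < y) xs"
  have xs: "xs = us @ vs" by (simp add: us_def vs_def)
  have us: "x < y" if "y \<in> set us" for y
    using that by (auto simp: us_def dest: set_takeWhileD)
  \<comment> \<open>A letter above \<open>x\<close> after the first smaller letter \<open>v\<close>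
    would complete a 213 with \<open>x\<close> and \<open>v\<close>.\<close>
  have vs: "y < x" if y: "y \<in> set vs" for y
  proof (cases vs)
    case (Cons v vs')
    then have "\<not> x < v"
      using hd_dropWhile[of "\<lambda>y. x < y" xs] by (simp add: vs_def)
    moreover have "v \<noteq> x" using Cons.prems(1) by (auto simp: xs Cons)
    ultimately have v: "v < x" by simp
    show ?thesis
    proof (cases "y = v")
      case False
      then have "subseq [v, y] vs" using y Cons by (simp add: subseq_singleton_left)
      then have "subseq [v, y] xs" by (simp add: xs list_emb_append2)
      then have "\<not> x < y" using pairs v by blast
      moreover have "y \<noteq> x" using Cons.prems(1) y by (auto simp: xs)
      ultimately show ?thesis by simp
    qed (use v in simp)
  qed (use y in simp)
  have "sorted vs"
  proof (rule sorted_if_subseq)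
    fix y z assume yz: "subseq [y, z] vs"
    then have "subseq [y, z] xs" unfolding xs by (rule list_emb_append2)
    moreover have "y < x" using vs subseq_set_subset[OF yz] by simp
    ultimately show "y \<le> z" using pairs[of y z] by auto
  qed
  have len: "length (filter (\<lambda>y. y < x) xs) = length vs"
  proof -
    have "filter (\<lambda>y. y < x) us = []" using us by (auto simp: filter_empty_conv dest: less_not_sym)
    moreover have "filter (\<lambda>y. y < x) vs = vs" using vs by (simp add: filter_id_conv)
    ultimately show ?thesis by (simp add: xs)
  qed
  have code: "lehmer xs = map ((+) (length vs)) (lehmer us) @ replicate (length vs) 0"
    using lehmer_append_greater[of us vs] less_trans[OF vs us] \<open>sorted vs\<close>
    by (simp add: xs lehmer_sorted)
  show ?case
  proof (cases "vs = []")
    case True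
    then have "lehmer (x # xs) = replicate (Suc c) 0 @ replicate a b @ replicate b 0"
      by (simp add: len IH)
    then show ?thesis by blast
  next
    case vs_ne: False
    show ?thesis
    proof (cases "us = []")
      case True
      \<comment> \<open>The tail is increasing here, so \<open>x\<close> forms a block of width
        one.\<close>
      then have "lehmer (x # xs) = replicate 0 0 @ replicate 1 (length vs) @ replicate (length vs) 0"
        by (simp add: len code)
      then show ?thesis by blast
    next
      case False
      \<comment> \<open>Letters of \<open>us\<close> exceed all of \<open>vs\<close>, so the code of
        the tail starts with a positive entry and its form has no leading zeros.\<close>
      obtain e es where e: "lehmer xs = e # es" "length vs \<le> e"
        using False unfolding code by (cases us) auto
      then have "0 < e" using vs_ne by (cases vs) auto
      then have c: "c = 0" using e(1) by (cases c) (auto simp: IH)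
      have a: "0 < a" using e(1) \<open>0 < e\<close> by (cases a; cases b) (auto simp: IH c)
      then have b: "0 < b" using e(1) \<open>0 < e\<close> by (cases a) (auto simp: IH c)
      \<comment> \<open>Counting the zeros of the tail's code in both of its descriptions shows that
        the new entry equals the height \<open>b\<close> of the existing block.\<close>
      have "length vs = length (filter (\<lambda>y. y = 0) (lehmer xs))"
        using vs_ne by (simp add: code filter_empty_conv)
      also have "\<dots> = b"
        using a b by (simp add: IH c)
      finally have "lehmer (x # xs) = replicate 0 0 @ replicate (Suc a) b @ replicate b 0"
        by (simp add: len IH c)
      then show ?thesis by blast
    qed
  qed
qed

section \<open>Direct sum decomposition of permutations with few inversions\<close>

lemma nth_lehmer_append:
  "lehmer (us @ x # ws) ! length us = length (filter (\<lambda>y. y < x) ws)"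
  by (induction us) auto

text \<open>Take for \<open>j\<close> the position of the maximum of the first \<open>s\<close>
  letters: it exceeds the \<open>s - j - 1\<close> letters between it and the cut, and also
  \<open>y\<close> behind the cut.\<close>

lemma lehmer_ge_if_crossing:
  assumes "distinct xs" "x \<in> set (take s xs)" "y \<in> set (drop s xs)" "y < x"
  obtains j where "j < s" "s \<le> j + lehmer xs ! j"
proof -
  define M where "M = Max (set (take s xs))"
  have "set (take s xs) \<noteq> {}" using assms(2) by (metis empty_iff)
  then have "M \<in> set (take s xs)" unfolding M_def by (rule Max_in[OF finite_set])
  then obtain us vs where split: "take s xs = us @ M # vs" by (auto dest: split_list)
  have dist: "distinct (take s xs)" using assms(1) by simp
  have "\<forall>v\<in>set vs. v < M"
  proof
    fix v assume v: "v \<in> set vs"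
    then have "v \<in> set (take s xs)" by (simp add: split)
    then have "v \<le> M" unfolding M_def by (rule Max_ge[OF finite_set])
    moreover have "v \<noteq> M" using dist v by (auto simp: split)
    ultimately show "v < M" by simp
  qed
  then have "filter (\<lambda>y. y < M) vs = vs" by (simp add: filter_id_conv)
  moreover have "x \<le> M" using assms(2) unfolding M_def by (rule Max_ge[OF finite_set])
  then have "y < M" using assms(4) by simp
  then have "filter (\<lambda>y. y < M) (drop s xs) \<noteq> []"
    using assms(3) unfolding filter_empty_conv by blast
  moreover have "us @ M # (vs @ drop s xs) = xs"
    using append_take_drop_id[of s xs] unfolding split by (simp only: append_assoc append_Cons)
  then have "lehmer xs ! length us = length (filter (\<lambda>y. y < M) (vs @ drop s xs))"
    using nth_lehmer_append[of us M "vs @ drop s xs"] by (simp only:)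
  ultimately have "lehmer xs ! length us \<ge> length vs + 1"
    by (simp add: Suc_le_eq)
  moreover have "s < length xs" using assms(3) by (cases "s < length xs") auto
  then have "s = length us + 1 + length vs"
    using arg_cong[OF split, of length] by simp
  ultimately show thesis by (intro that[of "length us"]) auto
qed

text \<open>
  If no cut at \<open>s\<close> separates small from large entries, then every \<open>s\<close> lies in one of the
  intervals \<open>(j, j + c\<^sub>j]\<close> for the Lehmer code \<open>c\<close>, whose lengths add up to the number of inversions.
\<close>

lemma split_if_few_inversions:
  assumes "distinct xs" "sum_list (lehmer xs) + 2 \<le> length xs"
  obtains us vs where "xs = us @ vs" "us \<noteq> []" "vs \<noteq> []"
    "\<And>x y. x \<in> set us \<Longrightarrow> y \<in> set vs \<Longrightarrow> x < y"
proof (rule ccontr)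
  assume no: "\<not> thesis"
  let ?n = "length xs"
  have "{1..<?n} \<subseteq> (\<Union>j<?n. {j<..j + lehmer xs ! j})"
  proof
    fix s assume s: "s \<in> {1..<?n}"
    then have "take s xs \<noteq> []" "drop s xs \<noteq> []" by auto
    with no that[of "take s xs" "drop s xs"]
    have "\<exists>x y. x \<in> set (take s xs) \<and> y \<in> set (drop s xs) \<and> \<not> x < y" by auto
    then obtain x y where xy: "x \<in> set (take s xs)" "y \<in> set (drop s xs)" "\<not> x < y" by blast
    have "set (take s xs) \<inter> set (drop s xs) = {}"
      using assms(1) by (simp add: set_take_disj_set_drop_if_distinct)
    with xy have "y < x" by (metis disjoint_iff linorder_neqE)
    with xy assms(1) obtain j where "j < s" "s \<le> j + lehmer xs ! j"
      by (auto elim: lehmer_ge_if_crossing)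
    with s show "s \<in> (\<Union>j<?n. {j<..j + lehmer xs ! j})"
      by (intro UN_I[of j]) auto
  qed
  then have "card {1..<?n} \<le> card (\<Union>j<?n. {j<..j + lehmer xs ! j})"
    by (intro card_mono) auto
  also have "\<dots> \<le> (\<Sum>j<?n. card {j<..j + lehmer xs ! j})"
    by (rule card_UN_le) simp
  also have "\<dots> = sum_list (lehmer xs)"
    by (simp add: sum_list_sum_nth atLeast0LessThan)
  \<comment> \<open>There are \<open>?n - 1\<close> cuts, at least one more than there are
    inversions.\<close>
  finally show False using assms(2) by simp
qed

subsection \<open>Partitions with a marked part\<close>

text \<open>The first entry is at most the sum. Dropping a positive entry keeps the sum below the
  length; if the first entry is zero, so are all others.\<close>

lemma subdiagonal_if_decreasing:
  "sorted (rev c) \<Longrightarrow> sum_list c < length c \<Longrightarrow> subdiagonal c"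
proof (induction c)
  case (Cons e c)
  have e: "\<forall>x\<in>set c. x \<le> e" and c: "sorted (rev c)"
    using Cons.prems(1) by (auto simp: sorted_append)
  have "subdiagonal c"
  proof (cases "c = [] \<or> 0 < e")
    case True
    then show ?thesis using Cons.IH[OF c] Cons.prems(2) by auto
  next
    case False
    then have "sum_list c = 0" using e by (simp add: sum_list_eq_0_iff)
    then have "sum_list c < length c" using False by (simp only: length_greater_0_conv) simp
    then show ?thesis by (rule Cons.IH[OF c])
  qed
  then show ?case using Cons.prems(2) by simp
qed simp

text \<open>The parts in weakly decreasing order, filled up with zeros; the length is
  \<open>m\<close> as long as \<open>M\<close> has at most \<open>m\<close> parts.\<close>

definition padded :: "nat \<Rightarrow> nat multiset \<Rightarrow> nat list" where
  "padded m M = rev (sorted_list_of_multiset (M + replicate_mset (m - size M) 0))"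

lemma mset_padded: "mset (padded m M) = M + replicate_mset (m - size M) 0"
  by (simp add: padded_def)

lemma length_padded: "size M \<le> m \<Longrightarrow> length (padded m M) = m"
  by (simp add: mset_padded flip: size_mset)

lemma sum_list_padded: "sum_list (padded m M) = \<Sum>\<^sub># M"
  by (simp add: mset_padded flip: sum_mset_sum_list)

lemma sorted_rev_padded: "sorted (rev (padded m M))"
  by (simp add: padded_def)

text \<open>The guaranteed final zero separates the partition from a following block.\<close>

lemma rev_padded:
  assumes "size M < m"
  obtains xs where "rev (padded m M) = 0 # xs"
proof -
  obtain d where "m - size M = Suc d" using assms by (metis Suc_diff_Suc)
  then have "rev (padded m M) = insort 0 (sorted_list_of_multiset (M + replicate_mset d 0))"
    by (simp add: padded_def)
  also have "\<dots> = 0 # sorted_list_of_multiset (M + replicate_mset d 0)"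
    by (rule insort_is_Cons) simp
  finally show thesis by (rule that)
qed

lemma padded_eq:
  assumes "sorted (rev xs)"
  shows "padded (length xs) {#x \<in># mset xs. 0 < x#} = xs"
proof -
  have "mset xs = {#x \<in># mset xs. 0 < x#} + {#x \<in># mset xs. \<not> 0 < x#}"
    by (rule multiset_partition)
  also have "{#x \<in># mset xs. \<not> 0 < x#} = replicate_mset (count (mset xs) 0) 0"
    by (simp add: filter_eq_replicate_mset)
  finally have split: "mset xs = {#x \<in># mset xs. 0 < x#} + replicate_mset (count (mset xs) 0) 0" .
  from arg_cong[OF this, of size]
  have "length xs - size {#x \<in># mset xs. 0 < x#} = count (mset xs) 0" by simp
  then have "padded (length xs) {#x \<in># mset xs. 0 < x#} = rev (sorted_list_of_multiset (mset (rev xs)))"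
    unfolding padded_def by (simp only: split[symmetric] mset_rev)
  also have "\<dots> = rev (sort (rev xs))" by (simp only: sorted_list_of_multiset_mset)
  also have "\<dots> = xs" using assms by (simp add: sorted_sort_id)
  finally show ?thesis .
qed

lemma size_le_sum_mset: "0 \<notin># M \<Longrightarrow> size M \<le> \<Sum>\<^sub># M" for M :: "nat multiset"
  by (induction M) auto

definition parts :: "nat \<Rightarrow> nat multiset set" where
  "parts k = {M. 0 \<notin># M \<and> \<Sum>\<^sub># M = k}"

text \<open>
  \<open>(M, a, b)\<close> marks \<open>a\<close> of the copies of the part \<open>b\<close> in \<open>M\<close>; the unmarked partition is \<open>(M, 0, 0)\<close>.
  The marked copies become the \<open>a \<times> b\<close> block at the end of the permutation.
\<close>

definition marked_parts :: "nat \<Rightarrow> (nat multiset \<times> nat \<times> nat) set" where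
  "marked_parts k = (SIGMA M:parts k. insert (0, 0) {(a, b). 1 \<le> a \<and> a \<le> count M b})"

definition marked_code :: "nat \<Rightarrow> nat multiset \<times> nat \<times> nat \<Rightarrow> nat list" where
  "marked_code n = (\<lambda>(M, a, b).
     padded (n - a - b) (M - replicate_mset a b) @ replicate a b @ replicate b 0)"

text \<open>\<open>N\<close> is the unmarked rest. From \<open>a + b <= a * b + 1\<close> and
  \<open>n >= k + 2\<close>, the room \<open>n - a - b\<close> left for \<open>N\<close> exceeds its
  sum; without a mark it does so by at least two.\<close>

lemma marked_partsE:
  assumes "(M, a, b) \<in> marked_parts k" "k + 2 \<le> n"
  obtains N where "N = M - replicate_mset a b" "M = N + replicate_mset a b" "0 \<notin># N"
    "\<Sum>\<^sub># N + a * b = k" "a + b \<le> n" "\<Sum>\<^sub># N + 1 < n - a - b + (if a = 0 then 0 else 1)"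
    "size N \<le> \<Sum>\<^sub># N" "a = 0 \<longleftrightarrow> b = 0"
proof -
  define N where "N = M - replicate_mset a b"
  have M: "0 \<notin># M" "\<Sum>\<^sub># M = k" and ab: "a = 0 \<and> b = 0 \<or> 1 \<le> a \<and> a \<le> count M b"
    using assms(1) by (auto simp: marked_parts_def parts_def)
  have "replicate_mset a b \<subseteq># M"
    using ab by (auto simp: count_le_replicate_mset_subset_eq)
  then have MN: "M = N + replicate_mset a b" by (simp add: N_def)
  have N: "0 \<notin># N" using M(1) by (auto simp: MN)
  have sum: "\<Sum>\<^sub># N + a * b = k" using M(2) by (simp add: MN)
  have ab0: "a = 0 \<longleftrightarrow> b = 0" using ab M(1) by (cases b) (auto simp: not_in_iff)
  have "a + b \<le> a * b + 1" if "a \<noteq> 0"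
    using that ab0 by (cases a; cases b) auto
  then show thesis
    using that[OF N_def MN N sum _ _ size_le_sum_mset[OF N] ab0] sum ab0 assms(2)
    by (cases "a = 0") auto
qed

section \<open>Injectivity of the encoding\<close>

lemma filter_replicate_mset:
  "filter_mset P (replicate_mset n x) = (if P x then replicate_mset n x else {#})"
  by (induction n) auto

text \<open>The positive entries give \<open>M\<close>. The code is weakly decreasing iff there is
  no mark; otherwise, read from the right, it begins with \<open>b\<close> zeros and then
  \<open>a\<close> positive entries.\<close>

lemma marked_code_inj:
  assumes "k + 2 \<le> n"
  shows "inj_on (marked_code n) (marked_parts k)"
proof -
  define decode where "decode c = ({#x \<in># mset c. 0 < x#},
     if sorted (rev c) then (0, 0)
     else (length (takeWhile (\<lambda>x. 0 < x) (dropWhile (\<lambda>x. x = 0) (rev c))),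
       length (takeWhile (\<lambda>x. x = 0) (rev c))))" for c :: "nat list"
  have "decode (marked_code n (M, a, b)) = (M, a, b)" if M: "(M, a, b) \<in> marked_parts k" for M a b
  proof -
    obtain N where N: "N = M - replicate_mset a b" "M = N + replicate_mset a b" "0 \<notin># N"
      "\<Sum>\<^sub># N + 1 < n - a - b + (if a = 0 then 0 else 1)"
      "size N \<le> \<Sum>\<^sub># N" "a = 0 \<longleftrightarrow> b = 0"
      by (rule marked_partsE[OF M assms])
    define c where "c = marked_code n (M, a, b)"
    have c: "c = padded (n - a - b) N @ replicate a b @ replicate b 0"
      by (simp add: c_def marked_code_def N(1))
    have "{#x \<in># N. 0 < x#} = N"
      using N(3) by (auto simp: filter_mset_eq_conv intro: gr0I)
    then have "{#x \<in># mset c. 0 < x#} = N + replicate_mset a b"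
      using N(6) by (auto simp: c mset_padded filter_replicate_mset)
    moreover have "(if sorted (rev c) then (0, 0)
      else (length (takeWhile (\<lambda>x. 0 < x) (dropWhile (\<lambda>x. x = 0) (rev c))),
        length (takeWhile (\<lambda>x. x = 0) (rev c)))) = (a, b)"
    proof (cases "a = 0")
      case True
      then show ?thesis using N(6) by (simp add: c sorted_rev_padded)
    next
      case False
      then have ab: "0 < a" "0 < b" using N(6) by auto
      \<comment> \<open>At least one padding zero precedes the block, so its left end can be
        recognised and the code is not weakly decreasing.\<close>
      have "size N < n - a - b" using N(4,5) False by simp
      then obtain r where "rev (padded (n - a - b) N) = 0 # r" by (rule rev_padded)
      then have rev: "rev c = replicate b 0 @ replicate a b @ 0 # r"
        by (simp add: c)
      show ?thesis
        using ab unfolding rev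
        by (simp add: sorted_append takeWhile_append dropWhile_append)
    qed
    ultimately show ?thesis
      unfolding decode_def c_def[symmetric] N(2)[symmetric] by simp
  qed
  then show ?thesis by (intro inj_on_inverseI[of _ decode]) auto
qed

section \<open>Avoiding permutations correspond to marked partitions\<close>

lemma sum_mset_filter_pos: "\<Sum>\<^sub># {#x \<in># M. 0 < x#} = \<Sum>\<^sub># M" for M :: "nat multiset"
  by (induction M) auto

lemma lehmer_in_marked_code:
  assumes \<pi>: "\<pi> \<in> permutations_of_set {1..n}" and k: "card (inversions \<pi>) = k" "k + 2 \<le> n"
    and av: "avoids \<pi> [1,3,2,4]" "avoids \<pi> [1,4,3,2]"
  shows "lehmer \<pi> \<in> marked_code n ` marked_parts k"
proof -
  have dist: "distinct \<pi>" and "set \<pi> = {1..n}"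
    using \<pi> by (auto dest: permutations_of_setD)
  then have len: "length \<pi> = n"
    using distinct_card[of \<pi>] by simp
  have sum: "sum_list (lehmer \<pi>) = k" using k(1) by (simp add: card_inversions)
  obtain us vs where split: "\<pi> = us @ vs" "us \<noteq> []" "vs \<noteq> []"
    and less: "\<And>x y. x \<in> set us \<Longrightarrow> y \<in> set vs \<Longrightarrow> x < y"
    using split_if_few_inversions[OF dist] sum len k(2) by metis
  have "avoids us [1,3,2] \<and> avoids vs [2,1,3] \<and> avoids vs [3,2,1]"
    using av avoids_append_iff[OF split(2,3) less] unfolding split(1) by blast
  moreover have "distinct us" "distinct vs" using dist split(1) by auto
  ultimately have us: "sorted (rev (lehmer us))"
    and "\<exists>c a b. lehmer vs = replicate c 0 @ replicate a b @ replicate b 0"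
    using avoids_132_iff_lehmer lehmer_avoids_213_321 by blast+
  then obtain c a b where vs: "lehmer vs = replicate c 0 @ replicate a b @ replicate b 0"
    by blast
  \<comment> \<open>The leading zeros in the code of \<open>vs\<close> serve as further padding
    after the partition given by \<open>us\<close>.\<close>
  define xs where "xs = lehmer us @ replicate c 0"
  have xs: "sorted (rev xs)" using us by (simp add: xs_def sorted_append)
  have code: "lehmer \<pi> = xs @ replicate a b @ replicate b 0"
    unfolding split(1) using lehmer_append_less[OF less] by (simp add: xs_def vs)
  show ?thesis
  proof (cases "a = 0 \<or> b = 0")
    case True
    \<comment> \<open>A degenerate block consists of zeros only, so the whole code is a padded
      partition without a mark.\<close>
    then obtain d where "lehmer \<pi> = xs @ replicate d 0" by (auto simp: code)
    then have sorted: "sorted (rev (lehmer \<pi>))" using xs by (simp add: sorted_append)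
    let ?M = "{#x \<in># mset (lehmer \<pi>). 0 < x#}"
    have "\<Sum>\<^sub># ?M = k"
      using sum by (simp only: sum_mset_filter_pos sum_mset_sum_list)
    then have "(?M, 0, 0) \<in> marked_parts k"
      by (simp add: marked_parts_def parts_def)
    moreover have "marked_code n (?M, 0, 0) = lehmer \<pi>"
      using padded_eq[OF sorted] by (simp add: marked_code_def len)
    ultimately show ?thesis by (metis image_eqI)
  next
    case False
    let ?N = "{#x \<in># mset xs. 0 < x#}"
    let ?M = "?N + replicate_mset a b"
    have "\<Sum>\<^sub># ?N = sum_list xs"
      by (simp only: sum_mset_filter_pos sum_mset_sum_list)
    then have "\<Sum>\<^sub># ?M = k"
      using sum by (simp add: code sum_list_replicate)
    then have "(?M, a, b) \<in> marked_parts k"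
      using False by (simp add: marked_parts_def parts_def)
    moreover have "length xs = n - a - b"
      using arg_cong[OF code, of length] by (simp add: len)
    then have "marked_code n (?M, a, b) = lehmer \<pi>"
      using padded_eq[OF xs] by (simp add: marked_code_def code)
    ultimately show ?thesis by (metis image_eqI)
  qed
qed

text \<open>The permutation is the direct sum of the 132-avoider with code \<open>c\<close> and of
  \<open>hi @ lo\<close>, two increasing runs of consecutive values with \<open>hi\<close> above
  \<open>lo\<close>. Both summands are nonempty, by \<open>sum_list c < length c\<close> and
  \<open>0 < a + b\<close>.\<close>

lemma perm_with_code:
  assumes c: "sorted (rev c)" "sum_list c < length c" and "0 < a + b"
  shows "\<exists>\<pi>\<in>permutations_of_set {1..length c + a + b}.
    lehmer \<pi> = c @ replicate a b @ replicate b 0 \<and> avoids \<pi> [1,3,2,4] \<and> avoids \<pi> [1,4,3,2]"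
proof -
  define s where "s = length c"
  have "length c = card {1..s}" by (simp add: s_def)
  moreover have "subdiagonal c" using c by (rule subdiagonal_if_decreasing)
  ultimately obtain us where us: "us \<in> permutations_of_set {1..s}" "lehmer us = c"
    by (rule lehmer_surj[OF finite_atLeastAtMost])
  have us': "set us = {1..s}" "distinct us"
    using us(1) by (auto dest: permutations_of_setD)
  define hi lo where "hi = [s + b + 1..<s + b + a + 1]" and "lo = [s + 1..<s + b + 1]"
  have set: "set hi = {s + b + 1..s + b + a}" "set lo = {s + 1..s + b}"
    by (auto simp: hi_def lo_def simp del: upt_Suc)
  have greater: "y < x" if "x \<in> set hi" "y \<in> set lo" for x y
    using that by (simp add: set)
  have less: "x < y" if "x \<in> set us" "y \<in> set (hi @ lo)" for x y
    using that by (auto simp: us' set)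
  have sorted: "sorted hi" "sorted lo" and len: "length hi = a" "length lo = b"
    and dist: "distinct hi" "distinct lo"
    by (simp_all add: hi_def lo_def del: upt_Suc)
  have "us \<noteq> []" using c(2) us(2) by (cases us) auto
  moreover have "hi @ lo \<noteq> []" using assms(3) len by (cases hi; cases lo) auto
  ultimately have avoid: "avoids (us @ hi @ lo) [1,3,2,4] \<and> avoids (us @ hi @ lo) [1,4,3,2] \<longleftrightarrow>
      avoids us [1,3,2] \<and> avoids (hi @ lo) [2,1,3] \<and> avoids (hi @ lo) [3,2,1]"
    using less by (rule avoids_append_iff)
  have us_avoids: "avoids us [1,3,2]"
    using c(1) unfolding avoids_132_iff_lehmer[OF us'(2)] us(2) .
  have vs_avoids: "avoids (hi @ lo) [2,1,3]" "avoids (hi @ lo) [3,2,1]"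
    using avoids_213_321_append(1)[OF sorted] avoids_213_321_append(2)[OF sorted] greater by metis+
  show ?thesis
  proof (intro bexI conjI)
    show "avoids (us @ hi @ lo) [1,3,2,4]" "avoids (us @ hi @ lo) [1,4,3,2]"
      using avoid us_avoids vs_avoids by blast+
    show "lehmer (us @ hi @ lo) = c @ replicate a b @ replicate b 0"
      using lehmer_append_less[of us "hi @ lo", OF less] lehmer_append_greater[of hi lo, OF greater]
      by (simp add: us(2) lehmer_sorted sorted len)
    have "set (us @ hi @ lo) = {1..length c + a + b}"
      by (auto simp: us' set s_def)
    moreover have "distinct (us @ hi @ lo)"
      using us'(2) dist by (auto simp: us'(1) set)
    ultimately show "us @ hi @ lo \<in> permutations_of_set {1..length c + a + b}"
      by (rule permutations_of_setI)
  qed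
qed

lemma marked_code_realised:
  assumes "(M, a, b) \<in> marked_parts k" "k + 2 \<le> n"
  shows "\<exists>\<pi>\<in>permutations_of_set {1..n}. lehmer \<pi> = marked_code n (M, a, b) \<and>
    avoids \<pi> [1,3,2,4] \<and> avoids \<pi> [1,4,3,2]"
proof -
  obtain N where N: "N = M - replicate_mset a b" "a + b \<le> n"
    "\<Sum>\<^sub># N + 1 < n - a - b + (if a = 0 then 0 else 1)"
    "size N \<le> \<Sum>\<^sub># N" "a = 0 \<longleftrightarrow> b = 0"
    by (rule marked_partsE[OF assms])
  have code: "marked_code n (M, a, b) = padded (n - a - b) N @ replicate a b @ replicate b 0"
    by (simp add: marked_code_def N(1))
  have len: "length (padded (n - a - b) N) = n - a - b"
    using N(3,4) by (intro length_padded) (auto split: if_splits)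
  show ?thesis
  proof (cases "a = 0")
    case True
    with N have b: "b = 0" by simp
    have "size N < n" using N(3,4) True b by simp
    then obtain r where "rev (padded n N) = 0 # r" by (rule rev_padded)
    \<comment> \<open>Without a mark, the last padding zero plays the second summand: it is the
      block for \<open>a = 0\<close> and \<open>b = 1\<close>. One zero fewer still leaves the
      length above the sum.\<close>
    then have r: "padded n N = rev r @ [0]" by (metis rev.simps(2) rev_swap)
    have "length r + 1 = n" using len True b r by simp
    moreover have "sum_list r = \<Sum>\<^sub># N" using sum_list_padded[of n N] by (simp add: r)
    moreover have "sorted r" using sorted_rev_padded[of n N] by (simp add: r)
    ultimately show ?thesis
      using perm_with_code[of "rev r" 0 1] N(3) unfolding code by (simp add: r True b sum_list_rev)
  next
    case False
    then have "sum_list (padded (n - a - b) N) < length (padded (n - a - b) N)"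
      using N(3) unfolding len by (simp add: sum_list_padded)
    from perm_with_code[OF sorted_rev_padded this, of a b] False N(2) show ?thesis
      unfolding code len by simp
  qed
qed

text \<open>\<open>lehmer\<close> on the avoiders and \<open>marked_code n\<close> on the marked
  partitions are injective with the same image.\<close>

lemma av_eq_card_marked_parts:
  assumes "k + 2 \<le> n"
  shows "av n k {[1,3,2,4], [1,4,3,2]} = card (marked_parts k)"
proof -
  let ?A = "{\<pi> \<in> permutations_of_set {1..n}. card (inversions \<pi>) = k \<and>
    (\<forall>q\<in>{[1,3,2,4], [1,4,3,2]}. avoids \<pi> q)}"
  have "inj_on lehmer (permutations_of_set {1..n})"
    by (rule inj_onI) (metis lehmer_eqD permutations_of_setD)
  then have "inj_on lehmer ?A" by (rule inj_on_subset) blast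
  moreover have "lehmer ` ?A = marked_code n ` marked_parts k"
  proof (intro equalityI subsetI)
    fix c assume "c \<in> lehmer ` ?A"
    then show "c \<in> marked_code n ` marked_parts k"
      using lehmer_in_marked_code[OF _ _ assms] by blast
  next
    fix c assume "c \<in> marked_code n ` marked_parts k"
    then obtain M a b where M: "(M, a, b) \<in> marked_parts k" "c = marked_code n (M, a, b)"
      by auto
    obtain \<pi> where \<pi>: "\<pi> \<in> permutations_of_set {1..n}" "lehmer \<pi> = c"
      "avoids \<pi> [1,3,2,4]" "avoids \<pi> [1,4,3,2]"
      using marked_code_realised[OF M(1) assms] M(2) by blast
    have "card (inversions \<pi>) = k"
    proof -
      obtain N where N: "N = M - replicate_mset a b" "\<Sum>\<^sub># N + a * b = k"
        by (rule marked_partsE[OF M(1) assms])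
      then show ?thesis
        by (simp add: card_inversions \<pi>(2) M(2) marked_code_def sum_list_padded sum_list_replicate)
    qed
    then show "c \<in> lehmer ` ?A" using \<pi> by blast
  qed
  ultimately show ?thesis
    unfolding av_def using marked_code_inj[OF assms] by (metis (no_types, lifting) card_image)
qed

subsection \<open>Counting\<close>

lemma finite_parts: "finite (parts k)"
proof (rule finite_subset)
  show "parts k \<subseteq> mset ` {xs. set xs \<subseteq> {..k} \<and> length xs \<le> k}"
  proof
    fix M assume M: "M \<in> parts k"
    obtain xs where xs: "M = mset xs" by (metis ex_mset)
    have "x \<le> k" if "x \<in> set xs" for x
      using M member_le_sum_list[OF that] by (simp add: parts_def xs sum_mset_sum_list)
    moreover have "length xs \<le> k"
      using M size_le_sum_mset[of M] by (simp add: parts_def xs)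
    ultimately show "M \<in> mset ` {xs. set xs \<subseteq> {..k} \<and> length xs \<le> k}"
      using xs by auto
  qed
qed (intro finite_imageI finite_lists_length_le finite_atMost)

text \<open>The possible marks of \<open>M\<close> number the sum of its multiplicities, that is
  \<open>size M\<close>; the pair \<open>(0, 0)\<close> adds one.\<close>

lemma card_marked_parts: "card (marked_parts k) = (\<Sum>M\<in>parts k. size M + 1)"
proof -
  have "finite (insert (0, 0) {(a, b). 1 \<le> a \<and> a \<le> count M b}) \<and>
    card (insert (0, 0) {(a, b). 1 \<le> a \<and> a \<le> count M b}) = size M + 1"
    for M :: "nat multiset"
  proof -
    have eq: "{(a, b). 1 \<le> a \<and> a \<le> count M b} = prod.swap ` (SIGMA b:set_mset M. {1..count M b})"
    proof (intro equalityI subsetI)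
      fix p assume "p \<in> {(a, b). 1 \<le> a \<and> a \<le> count M b}"
      then obtain a b where p: "p = (a, b)" and ab: "1 \<le> a" "a \<le> count M b" by blast
      then have "b \<in># M" by (intro count_inI) auto
      then have "(b, a) \<in> (SIGMA b:set_mset M. {1..count M b})" using ab by simp
      then show "p \<in> prod.swap ` (SIGMA b:set_mset M. {1..count M b})"
        unfolding p by (rule rev_image_eqI) simp
    qed auto
    have "card {(a, b). 1 \<le> a \<and> a \<le> count M b} = size M"
      unfolding eq by (simp add: card_image size_multiset_overloaded_eq)
    moreover have "finite {(a, b). 1 \<le> a \<and> a \<le> count M b}"
      unfolding eq by (intro finite_imageI finite_SigmaI) auto
    ultimately show ?thesis by simp
  qed
  then show ?thesis
    unfolding marked_parts_def using finite_parts by (subst card_SigmaI) auto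
qed

text \<open>A colouring is determined by the underlying partition \<open>M\<close> and the number
  \<open>j\<close> of red parts, which are the \<open>j\<close> smallest parts.\<close>

lemma card_blue_red:
  "card {(blue, red) \<in> blue_red_partitions k. \<forall>b\<in>#blue. \<forall>r\<in>#red. b \<ge> r} =
    (\<Sum>M\<in>parts k. size M + 1)"
proof -
  let ?A = "{(blue, red) \<in> blue_red_partitions k. \<forall>b\<in>#blue. \<forall>r\<in>#red. b \<ge> r}"
  let ?B = "SIGMA M:parts k. {..size M}"
  let ?l = "sorted_list_of_multiset :: nat multiset \<Rightarrow> nat list"
  define f where "f p = (case p of (blue, red) \<Rightarrow> (blue + red, size red))"
    for p :: "nat multiset \<times> nat multiset"
  define g where "g p = (case p of (M, j) \<Rightarrow> (mset (drop j (?l M)), mset (take j (?l M))))"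
    for p :: "nat multiset \<times> nat"
  have len: "length (?l M) = size M" for M
    by (metis mset_sorted_list_of_multiset size_mset)
  have union: "mset (drop j (?l M)) + mset (take j (?l M)) = M" for j M
    by (metis add.commute append_take_drop_id mset_append mset_sorted_list_of_multiset)
  have gf: "g (f p) = p" and fA: "f p \<in> ?B" if pA: "p \<in> ?A" for p
  proof -
    obtain blue red where p: "p = (blue, red)" by (cases p)
    have le: "\<forall>b\<in>#blue. \<forall>r\<in>#red. r \<le> b" and br: "(blue, red) \<in> blue_red_partitions k"
      using pA unfolding p by simp_all
    \<comment> \<open>Red parts listed before blue ones are already sorted, so cutting after
      \<open>size red\<close> entries recovers both colours.\<close>
    have "?l (blue + red) = sort (?l red @ ?l blue)"
      by (metis add.commute mset_append mset_sorted_list_of_multiset sorted_list_of_multiset_mset)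
    also have "\<dots> = ?l red @ ?l blue"
      using le by (intro sorted_sort_id) (auto simp: sorted_append)
    finally show "g (f p) = p" by (simp add: p f_def g_def len)
    show "f p \<in> ?B"
      using br by (simp add: p f_def blue_red_partitions_def parts_def)
  qed
  have fg: "f (g p) = p" and gB: "g p \<in> ?A" if pB: "p \<in> ?B" for p
  proof -
    obtain M j where p: "p = (M, j)" by (cases p)
    have M: "M \<in> parts k" and j: "j \<le> size M"
      using pB unfolding p by simp_all
    show "f (g p) = p" using j by (simp add: p f_def g_def union len)
    have "sorted (take j (?l M) @ drop j (?l M))" by simp
    then have "\<forall>b\<in>set (drop j (?l M)). \<forall>r\<in>set (take j (?l M)). r \<le> b"
      unfolding sorted_append by blast
    moreover have "0 \<notin># mset (drop j (?l M)) + mset (take j (?l M))"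
      "\<Sum>\<^sub># (mset (drop j (?l M)) + mset (take j (?l M))) = k"
      using M unfolding union by (simp_all add: parts_def)
    ultimately show "g p \<in> ?A"
      by (simp add: p g_def blue_red_partitions_def)
  qed
  have "bij_betw f ?A ?B"
  proof (rule bij_betw_byWitness[where f' = g])
    show "\<forall>p\<in>?A. g (f p) = p" by (intro ballI gf)
    show "\<forall>p\<in>?B. f (g p) = p" by (intro ballI fg)
    show "f ` ?A \<subseteq> ?B" by (intro image_subsetI fA)
    show "g ` ?B \<subseteq> ?A" by (intro image_subsetI gB)
  qed
  then have "card ?A = card ?B" by (rule bij_betw_same_card)
  also have "\<dots> = (\<Sum>M\<in>parts k. size M + 1)"
    using finite_parts by (subst card_SigmaI) auto
  finally show ?thesis .
qed

subsection \<open>The generating function\<close>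

definition parts_fps :: "nat \<Rightarrow> rat fps" where
  "parts_fps k = Abs_fps (\<lambda>n. of_nat (card {M \<in> parts n. size M = k}))"

lemma sum_mset_image_Suc: "\<Sum>\<^sub># (image_mset Suc M) = \<Sum>\<^sub># M + size M"
  by (induction M) auto

text \<open>The classical recursion: remove a part 1 if there is one, otherwise lower all
  \<open>Suc k\<close> parts by one. The new sum \<open>n - k\<close> is written additively to avoid
  truncated subtraction.\<close>

lemma parts_Suc_split:
  "{M \<in> parts (Suc n). size M = Suc k} =
    add_mset 1 ` {M \<in> parts n. size M = k} \<union>
    image_mset Suc ` {M. \<Sum>\<^sub># M + k = n \<and> 0 \<notin># M \<and> size M = Suc k}"
  (is "?L = ?R1 \<union> ?R2")
proof (intro equalityI subsetI)
  fix M assume M: "M \<in> ?L"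
  show "M \<in> ?R1 \<union> ?R2"
  proof (cases "1 \<in># M")
    case True
    then obtain N where N: "M = add_mset 1 N" by (metis multi_member_split)
    then have "N \<in> {M \<in> parts n. size M = k}" using M by (simp add: parts_def)
    then show ?thesis using N by blast
  next
    case False
    let ?N = "image_mset (\<lambda>x. x - 1) M"
    have "image_mset Suc ?N = image_mset id M"
      unfolding multiset.map_comp using M
      by (intro image_mset_cong) (auto simp: parts_def intro: Suc_pred gr0I)
    then have eq: "M = image_mset Suc ?N" by simp
    have "\<Sum>\<^sub># M = \<Sum>\<^sub># ?N + size ?N"
      using sum_mset_image_Suc[of ?N] unfolding eq[symmetric] .
    moreover have size: "size ?N = Suc k" using M by simp
    moreover have "\<Sum>\<^sub># M = Suc n" using M by (simp add: parts_def)
    ultimately have "\<Sum>\<^sub># ?N + k = n" by linarith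
    moreover have "0 \<notin># ?N"
    proof
      assume "0 \<in># ?N"
      then obtain x where "x \<in># M" "x - 1 = 0" by auto
      then have "0 \<in># M \<or> 1 \<in># M" by (cases x) auto
      then show False using M False by (simp add: parts_def)
    qed
    ultimately have "?N \<in> {M. \<Sum>\<^sub># M + k = n \<and> 0 \<notin># M \<and> size M = Suc k}"
      using size by blast
    then show ?thesis by (intro UnI2) (rule image_eqI, rule eq)
  qed
next
  fix M assume "M \<in> ?R1 \<union> ?R2"
  then show "M \<in> ?L"
  proof
    assume "M \<in> ?R2"
    then obtain N where N: "M = image_mset Suc N" "\<Sum>\<^sub># N + k = n" "size N = Suc k" by blast
    show ?thesis using N by (auto simp: parts_def sum_mset_image_Suc)
  qed (auto simp: parts_def)
qed

lemma card_parts_Suc: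
  "card {M \<in> parts (Suc n). size M = Suc k} =
    card {M \<in> parts n. size M = k} + (if k \<le> n then card {M \<in> parts (n - k). size M = Suc k} else 0)"
proof -
  let ?S = "{M. \<Sum>\<^sub># M + k = n \<and> 0 \<notin># M \<and> size M = Suc k}"
  have S: "?S = (if k \<le> n then {M \<in> parts (n - k). size M = Suc k} else {})"
    by (auto simp: parts_def)
  have "finite ?S" unfolding S using finite_parts by auto
  moreover have "add_mset 1 ` {M \<in> parts n. size M = k} \<inter> image_mset Suc ` ?S = {}"
  proof -
    have "1 \<notin># image_mset Suc N" if "N \<in> ?S" for N using that by auto
    moreover have "1 \<in># add_mset 1 N" for N :: "nat multiset" by simp
    ultimately show ?thesis by (metis (no_types, lifting) disjoint_iff imageE)
  qed
  moreover have "card (add_mset 1 ` {M \<in> parts n. size M = k}) = card {M \<in> parts n. size M = k}"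
    by (intro card_image) (auto simp: inj_on_def)
  moreover have "card (image_mset Suc ` ?S) = card ?S"
    by (intro card_image inj_on_subset[OF multiset.inj_map]) auto
  ultimately show ?thesis
    unfolding parts_Suc_split S using finite_parts by (subst card_Un_disjoint) auto
qed

text \<open>The recursion on coefficients: the factor \<open>fps_X\<close> accounts for an added
  part 1, and \<open>fps_X ^ Suc k\<close> for raising \<open>Suc k\<close> parts by one.\<close>

lemma parts_fps_Suc: "parts_fps (Suc k) = fps_X * parts_fps k + fps_X ^ Suc k * parts_fps (Suc k)"
proof (rule fps_ext)
  fix n
  show "fps_nth (parts_fps (Suc k)) n =
    fps_nth (fps_X * parts_fps k + fps_X ^ Suc k * parts_fps (Suc k)) n"
  proof (cases n)
    case 0
    have "size M \<noteq> Suc k" if "M \<in> parts 0" for M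
    proof -
      have "0 \<notin># M" and "\<Sum>\<^sub># M = 0"
        using that unfolding parts_def by blast+
      then show ?thesis using size_le_sum_mset[of M] by linarith
    qed
    then have "{M \<in> parts 0. size M = Suc k} = {}" by blast
    then have "card {M \<in> parts 0. size M = Suc k} = 0"
      by (simp only: card.empty)
    then show ?thesis by (simp add: 0 parts_fps_def fps_X_power_mult_nth del: power_Suc)
  next
    case (Suc m)
    then show ?thesis
      by (simp add: parts_fps_def card_parts_Suc fps_X_power_mult_nth del: power_Suc)
  qed
qed

lemma parts_fps_0: "parts_fps 0 = 1"
proof (rule fps_ext)
  fix n
  have "{M \<in> parts n. size M = 0} = (if n = 0 then {{#}} else {})"
    by (auto simp: parts_def)
  then show "fps_nth (parts_fps 0) n = fps_nth 1 n" by (simp add: parts_fps_def)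
qed

text \<open>Solving the recursion for \<open>parts_fps (Suc k)\<close> divides by
  \<open>1 - fps_X ^ Suc k\<close>, which is invertible as its constant term is 1.\<close>

lemma parts_fps_eq: "parts_fps k = fps_X ^ k * (\<Prod>i=1..k. 1 / (1 - fps_X ^ i))"
proof (induction k)
  case (Suc k)
  let ?d = "1 - fps_X ^ Suc k :: rat fps"
  have d: "fps_nth ?d 0 \<noteq> 0" by simp
  have "parts_fps (Suc k) * ?d = fps_X * parts_fps k"
    using parts_fps_Suc[of k] by (simp add: algebra_simps)
  then have "parts_fps (Suc k) * ?d * inverse ?d = fps_X * parts_fps k * inverse ?d"
    by simp
  then have "parts_fps (Suc k) = fps_X * parts_fps k * inverse ?d"
    using inverse_mult_eq_1'[OF d] by (simp only: mult.assoc mult_1_right)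
  also have "inverse ?d = 1 / ?d" using d by (simp add: fps_divide_unit)
  finally show ?case
    by (simp add: Suc.IH mult_ac)
qed (simp add: parts_fps_0)

text \<open>A series of formal power series converges when every coefficient of its partial sums is
  eventually constant.\<close>

lemma sums_fpsI:
  fixes f :: "nat \<Rightarrow> 'a::ab_group_add fps"
  assumes "\<And>n. \<exists>K0. \<forall>K\<ge>K0. (\<Sum>k<K. fps_nth (f k) n) = fps_nth g n"
  shows "f sums g"
  unfolding sums_def
  by (rule tendsto_fpsI) (use assms in \<open>simp add: fps_sum_nth eventually_sequentially\<close>)

lemma sums_parts_fps:
  "(\<lambda>k. of_nat (k + 1) * parts_fps k) sums Abs_fps (\<lambda>n. of_nat (\<Sum>M\<in>parts n. size M + 1))"
proof (rule sums_fpsI, intro exI allI impI)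
  \<comment> \<open>A partition of \<open>n\<close> has at most \<open>n\<close> parts, so the
    coefficient is constant from \<open>K = n + 1\<close> on.\<close>
  fix n K :: nat assume K: "n + 1 \<le> K"
  have sub: "size ` parts n \<subseteq> {..<K}"
  proof (rule image_subsetI)
    fix M assume "M \<in> parts n"
    then have "size M \<le> n" using size_le_sum_mset[of M] by (simp add: parts_def)
    then show "size M \<in> {..<K}" using K by simp
  qed
  \<comment> \<open>Grouping by the number \<open>k\<close> of parts gives every partition in the
    group weight \<open>k + 1\<close>.\<close>
  have "(\<Sum>M\<in>parts n. size M + 1) = (\<Sum>k<K. \<Sum>M\<in>{M \<in> parts n. size M = k}. size M + 1)"
    by (rule sum.group[OF finite_parts finite_lessThan sub, symmetric])
  also have "\<dots> = (\<Sum>k<K. (k + 1) * card {M \<in> parts n. size M = k})"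
    by (intro sum.cong) auto
  finally have "(\<Sum>M\<in>parts n. size M + 1) = (\<Sum>k<K. (k + 1) * card {M \<in> parts n. size M = k})" .
  moreover have "fps_nth (of_nat (k + 1) * parts_fps k) n =
      of_nat ((k + 1) * card {M \<in> parts n. size M = k})" for k
    unfolding fps_mult_of_nat_nth parts_fps_def fps_nth_Abs_fps of_nat_mult ..
  ultimately show "(\<Sum>k<K. fps_nth (of_nat (k + 1) * parts_fps k) n) =
      fps_nth (Abs_fps (\<lambda>n. of_nat (\<Sum>M\<in>parts n. size M + 1))) n"
    by (simp only: fps_nth_Abs_fps of_nat_sum[symmetric])
qed

theorem proposition5p8:
  shows "(\<forall>k n :: nat. n \<ge> k + 2 \<longrightarrow>
            av n k {[1,3,2,4], [1,4,3,2]} =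
              card {(blue, red) \<in> blue_red_partitions k. \<forall>b\<in>#blue. \<forall>r\<in>#red. b \<ge> r}) \<and>
         (\<exists>c. is_limit_seq {[1,3,2,4], [1,4,3,2]} c) \<and>
         (\<lambda>k. of_nat (k + 1) * fps_X ^ k * (\<Prod>i=1..k. 1 / (1 - fps_X ^ i)))
           sums limit_gf {[1,3,2,4], [1,4,3,2]}"
proof -
  have av: "av n k {[1,3,2,4], [1,4,3,2]} = (\<Sum>M\<in>parts k. size M + 1)" if "k + 2 \<le> n" for n k
    using av_eq_card_marked_parts[OF that] unfolding card_marked_parts .
  then have lim: "is_limit_seq {[1,3,2,4], [1,4,3,2]} (\<lambda>k. \<Sum>M\<in>parts k. size M + 1)"
    unfolding is_limit_seq_def by blast
  have "(\<lambda>k. of_nat (k + 1) * parts_fps k) sums limit_gf {[1,3,2,4], [1,4,3,2]}"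
    unfolding limit_gf_def limit_seq_eq[OF lim] by (rule sums_parts_fps)
  then have "(\<lambda>k. of_nat (k + 1) * fps_X ^ k * (\<Prod>i=1..k. 1 / (1 - fps_X ^ i)))
      sums limit_gf {[1,3,2,4], [1,4,3,2]}"
    unfolding parts_fps_eq mult.assoc[symmetric] .
  with av lim show ?thesis
    unfolding card_blue_red by (intro conjI allI impI exI)
qed

end
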